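(* Consider the scalar plant $$x_{k+1}=\tfrac32x_k+u_k,\qquad|u_k|\le1,\qquad x_0\sim\mathrm{Unif}[-1,1],$$ with measured output $y=x$. Let the benchmark class be all linear static output-feedback laws $u=Fy$, $F\in\mathbb{R}$, satisfying $|Fx|\le1$ for all $|x|\le1$. Then for every $\beta\in(0,1]$, $$\inf_F\ \mathbb{E}\sum_{k=0}^\infty\beta^kx_k^2=\frac{1}{3(1-\beta/4)},$$ where the infimum is over the benchmark class, and the minimizing gain is trajectory-wise admissible (it satisfies $|u_k|\le1$ for all $k\ge0$ and all $x_0\in[-1,1]$), so that imposing trajectory-wise input admissibility only restricts the class. The static two-ReLU output-feedback law $u=-\mathrm{sat}(1.5y)$ has cost $\mathbb{E}\sum_{k=0}^\infty\beta^kx_k^2=\frac13+\frac{\beta}{36}$, and hence has strictly smaller cost than every admissible linear static output-feedback controller.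
   Context: $\mathrm{sat}(r)=\max\{-1,\min\{r,1\}\}$. Costs take values in $[0,+\infty]$. *)

theory Defs
  imports "HOL-Probability.Probability"
begin

definition sat :: "real \<Rightarrow> real" where
  "sat r = max (- 1) (min r 1)"

definition relu :: "real \<Rightarrow> real" where
  "relu r = max 0 r"

definition plant_step :: "real \<Rightarrow> real \<Rightarrow> real" where
  "plant_step x u = 3 / 2 * x + u"

definition plant_output :: "real \<Rightarrow> real" where
  "plant_output x = x"

text \<open>A static output-feedback law is a function \<open>\<kappa>\<close> from the measured output to the input.\<close>

primrec state :: "(real \<Rightarrow> real) \<Rightarrow> real \<Rightarrow> nat \<Rightarrow> real" where
  "state \<kappa> x0 0 = x0"
| "state \<kappa> x0 (Suc k) = plant_step (state \<kappa> x0 k) (\<kappa> (plant_output (state \<kappa> x0 k)))"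

definition control_input :: "(real \<Rightarrow> real) \<Rightarrow> real \<Rightarrow> nat \<Rightarrow> real" where
  "control_input \<kappa> x0 k = \<kappa> (plant_output (state \<kappa> x0 k))"

definition trajectory_admissible :: "(real \<Rightarrow> real) \<Rightarrow> bool" where
  "trajectory_admissible \<kappa> \<longleftrightarrow> (\<forall>x0\<in>{-1..1}. \<forall>k. \<bar>control_input \<kappa> x0 k\<bar> \<le> 1)"

definition linear_law :: "real \<Rightarrow> real \<Rightarrow> real" where
  "linear_law F y = F * y"

text \<open>The benchmark constraint is imposed on the unit interval only, not along closed-loop
  trajectories, which may leave it.\<close>

definition benchmark_gains :: "real set" where
  "benchmark_gains = {F. \<forall>x. \<bar>x\<bar> \<le> 1 \<longrightarrow> \<bar>linear_law F (plant_output x)\<bar> \<le> 1}"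

text \<open>One hidden layer with two ReLU units and an affine output layer.\<close>

definition two_relu_law :: "(real \<Rightarrow> real) \<Rightarrow> bool" where
  "two_relu_law \<kappa> \<longleftrightarrow> (\<exists>a1 b1 a2 b2 w1 w2 c. \<forall>y.
     \<kappa> y = w1 * relu (a1 * y + b1) + w2 * relu (a2 * y + b2) + c)"

definition sat_law :: "real \<Rightarrow> real" where
  "sat_law y = - sat (3 / 2 * y)"

text \<open>The initial state is a random variable \<open>X0\<close> on \<open>M\<close>. Sum and expectation are taken in
  \<^typ>\<open>ennreal\<close>, so that unstable closed loops may have infinite cost.\<close>

definition cost :: "'a measure \<Rightarrow> ('a \<Rightarrow> real) \<Rightarrow> real \<Rightarrow> (real \<Rightarrow> real) \<Rightarrow> ennreal" where
  "cost M X0 \<beta> \<kappa> = (\<integral>\<^sup>+ \<omega>. (\<Sum>k. ennreal (\<beta> ^ k * (state \<kappa> (X0 \<omega>) k)\<^sup>2)) \<partial>M)"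

end

theory Submission
  imports Defs
begin

text \<open>Under \<open>u = F y\<close> the state is \<open>a\<^sup>k x\<^sub>0\<close> with \<open>a = 3/2 + F\<close>, so the cost is the geometric
  series with ratio \<open>\<beta> a\<^sup>2\<close> scaled by \<open>E x\<^sub>0\<^sup>2 = 1/3\<close>; on the benchmark class \<open>a \<ge> 1/2\<close>, with equality
  only at \<open>F = -1\<close>. Under the saturated law \<open>\<bar>x\<^sub>1\<bar> = max 0 (3\<bar>x\<^sub>0\<bar>/2 - 1) \<le> 1/2\<close>, and any state
  with \<open>\<bar>x\<bar> \<le> 2/3\<close> is steered to the origin in one step, so only \<open>x\<^sub>0\<close> and \<open>x\<^sub>1\<close> contribute, with
  \<open>E x\<^sub>1\<^sup>2 = 1/36\<close>. Strictness follows from \<open>1/(1 - \<beta>/4) \<ge> 1 + \<beta>/4\<close>.\<close>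

section \<open>Integrals against the uniform law, and the geometric series in
  \<open>ennreal\<close>\<close>

text \<open>Turns expectations into Lebesgue integrals that the fundamental theorem of calculus can
  evaluate; the divisor 2 is the length of the interval.\<close>

lemma nn_integral_uniform_distr:
  fixes M :: "'a measure" and X :: "'a \<Rightarrow> real" and g :: "real \<Rightarrow> ennreal"
  assumes "X \<in> borel_measurable M"
    and "distr M lborel X = uniform_measure lborel {-1..1}"
    and "g \<in> borel_measurable borel"
  shows "(\<integral>\<^sup>+ \<omega>. g (X \<omega>) \<partial>M) = (\<integral>\<^sup>+ x. g x * indicator {-1..1} x \<partial>lborel) / 2"
proof -
  have "(\<integral>\<^sup>+ \<omega>. g (X \<omega>) \<partial>M) = (\<integral>\<^sup>+ x. g x \<partial>distr M lborel X)"
    using assms by (intro nn_integral_distr[symmetric]) auto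
  also have "\<dots> = (\<integral>\<^sup>+ x. g x * indicator {-1..1} x \<partial>lborel) / emeasure lborel {-1..1::real}"
    unfolding assms(2) using assms(3) by (intro nn_integral_uniform_measure) auto
  finally show ?thesis by simp
qed

lemma nn_integral_square:
  "(\<integral>\<^sup>+ x. ennreal (x\<^sup>2) * indicator {-1..1} x \<partial>lborel) = ennreal (2 / 3)"
proof -
  have "(\<integral>\<^sup>+ x. ennreal (x\<^sup>2) * indicator {-1..1} x \<partial>lborel) = ennreal (1 ^ 3 / 3 - (- 1) ^ 3 / 3)"
    by (rule nn_integral_FTC_Icc[where F = "\<lambda>x. x ^ 3 / 3"])
      (auto intro!: derivative_eq_intros)
  then show ?thesis by simp
qed

text \<open>The divergent case matters: the benchmark class contains destabilising gains, such as
  \<open>F = 0\<close> with \<open>\<beta> = 1\<close>.\<close>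

lemma suminf_ennreal_geometric:
  assumes "0 \<le> r"
  shows "(\<Sum>k. ennreal (r ^ k)) = (if r < 1 then ennreal (1 / (1 - r)) else \<top>)"
proof (cases "r < 1")
  case True
  then have "(\<lambda>k. r ^ k) sums (1 / (1 - r))"
    using assms by (intro geometric_sums) simp
  then have "(\<Sum>k. ennreal (r ^ k)) = ennreal (1 / (1 - r))"
    using assms by (intro suminf_ennreal_eq) simp_all
  then show ?thesis using True by simp
next
  case False
  then have "\<not> summable (\<lambda>k. r ^ k)"
    using assms by simp
  then have "(\<Sum>k. ennreal (r ^ k)) = \<top>"
    using assms by (intro summable_iff_suminf_neq_top) simp_all
  then show ?thesis using False by simp
qed

section \<open>Linear laws: cost and admissibility\<close>

lemma state_linear_law: "state (linear_law F) x k = (3 / 2 + F) ^ k * x"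
  by (induction k) (simp_all add: plant_step_def plant_output_def linear_law_def algebra_simps)

lemma cost_linear_law:
  assumes "X0 \<in> borel_measurable M"
    and "distr M lborel X0 = uniform_measure lborel {-1..1}"
    and "0 < \<beta>"
  shows "cost M X0 \<beta> (linear_law F) =
    (if \<beta> * (3 / 2 + F)\<^sup>2 < 1 then ennreal (1 / (3 * (1 - \<beta> * (3 / 2 + F)\<^sup>2))) else \<top>)"
proof -
  define r where "r = \<beta> * (3 / 2 + F)\<^sup>2"
  have r: "0 \<le> r" using assms(3) by (simp add: r_def)
  have "(\<Sum>k. ennreal (\<beta> ^ k * (state (linear_law F) x k)\<^sup>2))
      = (\<Sum>k. ennreal (r ^ k)) * ennreal (x\<^sup>2)" for x
  proof -
    have "ennreal (\<beta> ^ k * (state (linear_law F) x k)\<^sup>2) = ennreal (r ^ k) * ennreal (x\<^sup>2)" for k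
    proof -
      have "\<beta> ^ k * (state (linear_law F) x k)\<^sup>2 = r ^ k * x\<^sup>2"
        by (simp add: state_linear_law r_def power_mult_distrib flip: power_mult)
          (simp add: mult.commute)
      then show ?thesis using r by (simp add: ennreal_mult)
    qed
    then show ?thesis by simp
  qed
  then have "cost M X0 \<beta> (linear_law F) =
      (\<integral>\<^sup>+ \<omega>. (\<Sum>k. ennreal (r ^ k)) * ennreal ((X0 \<omega>)\<^sup>2) \<partial>M)"
    by (simp add: cost_def)
  also have "\<dots> = (\<Sum>k. ennreal (r ^ k)) * (\<integral>\<^sup>+ \<omega>. ennreal ((X0 \<omega>)\<^sup>2) \<partial>M)"
    using assms(1) by (intro nn_integral_cmult) auto
  also have "(\<integral>\<^sup>+ \<omega>. ennreal ((X0 \<omega>)\<^sup>2) \<partial>M) = ennreal (2 / 3) / 2"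
    using nn_integral_uniform_distr[OF assms(1,2), of "\<lambda>x. ennreal (x\<^sup>2)"]
    by (simp add: nn_integral_square)
  also have "ennreal (2 / 3) / 2 = ennreal (1 / 3)"
    using divide_ennreal[of "2 / 3" 2] by simp
  finally have "cost M X0 \<beta> (linear_law F) = (\<Sum>k. ennreal (r ^ k)) * ennreal (1 / 3)" .
  \<comment> \<open>In the divergent case the factor 1/3 is nonzero, so the product with
    \<open>\<top>\<close> stays \<open>\<top>\<close>.\<close>
  then show ?thesis
    using r unfolding suminf_ennreal_geometric[OF r] r_def[symmetric]
    by (auto simp: ennreal_top_mult mult.commute simp flip: ennreal_mult)
qed

lemma benchmark_gains_eq: "benchmark_gains = {-1..1}"
proof (intro set_eqI iffI)
  fix F assume "F \<in> benchmark_gains"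
  then have "\<bar>x\<bar> \<le> 1 \<longrightarrow> \<bar>linear_law F (plant_output x)\<bar> \<le> 1" for x
    unfolding benchmark_gains_def by blast
  from this[of 1] have "\<bar>linear_law F (plant_output 1)\<bar> \<le> 1"
    by simp
  then show "F \<in> {-1..1}"
    by (simp add: linear_law_def plant_output_def abs_le_iff)
next
  fix F :: real assume "F \<in> {-1..1}"
  then have "\<bar>F\<bar> \<le> 1" by (simp add: abs_le_iff)
  then have "\<bar>F * x\<bar> \<le> 1" if "\<bar>x\<bar> \<le> 1" for x
    unfolding abs_mult using that by (intro mult_le_one) simp_all
  then show "F \<in> benchmark_gains"
    unfolding benchmark_gains_def linear_law_def plant_output_def by blast
qed

text \<open>At time 0 the state is \<open>x0\<close> itself, which ranges over the whole interval,
  so the instance \<open>k = 0\<close> is already the benchmark constraint.\<close>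

lemma trajectory_admissible_linear_subset:
  "{F. trajectory_admissible (linear_law F)} \<subseteq> benchmark_gains"
proof
  fix F assume "F \<in> {F. trajectory_admissible (linear_law F)}"
  then have *: "\<bar>control_input (linear_law F) x 0\<bar> \<le> 1" if "x \<in> {-1..1}" for x
    using that unfolding trajectory_admissible_def by blast
  have "\<bar>linear_law F (plant_output x)\<bar> \<le> 1" if "\<bar>x\<bar> \<le> 1" for x
  proof -
    have "x \<in> {-1..1}" using that by (simp add: abs_le_iff)
    from *[OF this] show ?thesis by (simp only: control_input_def state.simps)
  qed
  then show "F \<in> benchmark_gains"
    unfolding benchmark_gains_def by blast
qed

text \<open>The closed-loop factor is 3/2 - 1 = 1/2, so the state never leaves the unit interval.
  Hence the benchmark minimiser survives in the smaller class.\<close>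

lemma trajectory_admissible_linear_minus_one: "trajectory_admissible (linear_law (- 1))"
  unfolding trajectory_admissible_def
proof (intro ballI allI)
  fix x :: real and k
  assume "x \<in> {-1..1}"
  then have "\<bar>x\<bar> \<le> 1" by (simp add: abs_le_iff)
  moreover have "\<bar>(1 / 2 :: real) ^ k\<bar> \<le> 1"
    unfolding power_abs by (intro power_le_one) simp_all
  ultimately have "\<bar>(1 / 2) ^ k * x\<bar> \<le> 1"
    unfolding abs_mult by (intro mult_le_one) simp_all
  moreover have "control_input (linear_law (- 1)) x k = - ((1 / 2) ^ k * x)"
    unfolding control_input_def plant_output_def state_linear_law by (simp add: linear_law_def)
  ultimately show "\<bar>control_input (linear_law (- 1)) x k\<bar> \<le> 1"
    by (simp only: abs_minus_cancel)
qed

section \<open>The saturated law: ReLU form and cost\<close>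

text \<open>Below -1 both units are inactive, leaving -1; the first switches slope 1 on at -1, the
  second cancels it from 1 onwards.\<close>

lemma sat_eq_relu: "sat r = relu (r + 1) - relu (r - 1) - 1"
  by (simp add: sat_def relu_def)

lemma two_relu_law_sat_law: "two_relu_law sat_law"
proof -
  have "\<forall>y. sat_law y = - 1 * relu (3 / 2 * y + 1) + 1 * relu (3 / 2 * y + - 1) + 1"
    by (simp add: sat_law_def sat_eq_relu)
  then show ?thesis
    unfolding two_relu_law_def by blast
qed

lemma trajectory_admissible_sat_law: "trajectory_admissible sat_law"
  by (auto simp: trajectory_admissible_def control_input_def sat_law_def sat_def)

text \<open>The input saturates at the breakpoints -2/3 and 2/3; between them it cancels the drift
  exactly.\<close>

lemma plant_step_sat_law:
  "plant_step x (sat_law x) =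
    (if x \<le> - 2 / 3 then 3 / 2 * x + 1 else if x < 2 / 3 then 0 else 3 / 2 * x - 1)"
  by (simp add: plant_step_def sat_law_def sat_def)

lemma state_sat_law_Suc_Suc:
  assumes "\<bar>x\<bar> \<le> 1"
  shows "state sat_law x (Suc (Suc k)) = 0"
proof (induction k)
  case 0
  define z where "z = plant_step x (sat_law x)"
  have "\<bar>z\<bar> \<le> 1 / 2"
    using assms by (simp add: z_def plant_step_sat_law abs_le_iff)
  \<comment> \<open>Since 1/2 < 2/3, the first successor lies in the unsaturated zone.\<close>
  then have "\<not> z \<le> - 2 / 3" "z < 2 / 3"
    by linarith+
  then have "plant_step z (sat_law z) = 0"
    by (simp add: plant_step_sat_law)
  then show ?case
    by (simp add: plant_output_def z_def)
next
  case (Suc k)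
  then show ?case
    by (simp add: plant_output_def plant_step_sat_law)
qed

text \<open>Separates the two saturated tails, so that each integrand is a polynomial on a closed
  interval.\<close>

lemma state_sat_law_1_square:
  assumes "\<bar>x\<bar> \<le> 1"
  shows "ennreal ((state sat_law x 1)\<^sup>2) =
    ennreal ((3 / 2 * x + 1)\<^sup>2) * indicator {-1..-2/3} x + ennreal ((3 / 2 * x - 1)\<^sup>2) * indicator {2/3..1} x"
  using assms by (simp add: plant_output_def plant_step_sat_law indicator_def abs_le_iff)

lemma nn_integral_state_sat_law_1_square:
  "(\<integral>\<^sup>+ x. ennreal ((3 / 2 * x + 1)\<^sup>2) * indicator {-1..-2/3} x
      + ennreal ((3 / 2 * x - 1)\<^sup>2) * indicator {2/3..1} x \<partial>lborel) = ennreal (1 / 18)"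
proof -
  have "(\<integral>\<^sup>+ x. ennreal ((3 / 2 * x + 1)\<^sup>2) * indicator {-1..-2/3} x \<partial>lborel)
      = ennreal (2 / 9 * (3 / 2 * (- 2 / 3) + 1) ^ 3 - 2 / 9 * (3 / 2 * (- 1) + 1) ^ 3)"
    \<comment> \<open>The factor 2/9 is the inverse of 3 * 3/2, from the power and the inner slope.
      Each tail contributes 1/36.\<close>
    by (rule nn_integral_FTC_Icc[where F = "\<lambda>x. 2 / 9 * (3 / 2 * x + 1) ^ 3"])
      (auto intro!: derivative_eq_intros)
  moreover have "(\<integral>\<^sup>+ x. ennreal ((3 / 2 * x - 1)\<^sup>2) * indicator {2/3..1} x \<partial>lborel)
      = ennreal (2 / 9 * (3 / 2 * 1 - 1) ^ 3 - 2 / 9 * (3 / 2 * (2 / 3) - 1) ^ 3)"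
    by (rule nn_integral_FTC_Icc[where F = "\<lambda>x. 2 / 9 * (3 / 2 * x - 1) ^ 3"])
      (auto intro!: derivative_eq_intros)
  ultimately show ?thesis
    by (subst nn_integral_add) (auto simp: power3_eq_cube simp flip: ennreal_plus)
qed

lemma cost_sat_law:
  assumes "X0 \<in> borel_measurable M"
    and "distr M lborel X0 = uniform_measure lborel {-1..1}"
    and "0 < \<beta>"
  shows "cost M X0 \<beta> sat_law = ennreal (1 / 3 + \<beta> / 36)"
proof -
  let ?g = "\<lambda>x. \<Sum>k. ennreal (\<beta> ^ k * (state sat_law x k)\<^sup>2)"
  let ?h = "\<lambda>x::real. ennreal ((3 / 2 * x + 1)\<^sup>2) * indicator {-1..-2/3} x
      + ennreal ((3 / 2 * x - 1)\<^sup>2) * indicator {2/3..1} x"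
  have [measurable]: "(\<lambda>x. state sat_law x k) \<in> borel_measurable borel" for k
    by (induction k) (auto simp: plant_step_def plant_output_def sat_law_def sat_def)
  \<comment> \<open>Inside the unit interval only the terms \<open>k = 0\<close> and
    \<open>k = 1\<close> survive; outside it, all indicators vanish.\<close>
  have g: "?g x * indicator {-1..1} x
      = ennreal (x\<^sup>2) * indicator {-1..1} x + ennreal \<beta> * ?h x" for x
  proof (cases "\<bar>x\<bar> \<le> 1")
    case True
    have "?g x = (\<Sum>k\<in>{0, 1}. ennreal (\<beta> ^ k * (state sat_law x k)\<^sup>2))"
    proof (rule suminf_finite)
      fix k :: nat assume "k \<notin> {0, 1}"
      then obtain j where "k = Suc (Suc j)" by (cases k; cases "k - 1") auto
      then show "ennreal (\<beta> ^ k * (state sat_law x k)\<^sup>2) = 0"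
        using state_sat_law_Suc_Suc[OF True, of j] by simp
    qed simp
    also have "\<dots> = ennreal (x\<^sup>2) + ennreal \<beta> * ennreal ((state sat_law x 1)\<^sup>2)"
      using assms(3) by (simp add: ennreal_mult)
    finally show ?thesis
      using True unfolding state_sat_law_1_square[OF True] by (simp add: indicator_def abs_le_iff)
  next
    case False
    then show ?thesis by (auto simp: indicator_def abs_le_iff)
  qed
  have "cost M X0 \<beta> sat_law = (\<integral>\<^sup>+ x. ?g x * indicator {-1..1} x \<partial>lborel) / 2"
    unfolding cost_def by (rule nn_integral_uniform_distr[OF assms(1,2), of ?g]) measurable
  also have "(\<integral>\<^sup>+ x. ?g x * indicator {-1..1} x \<partial>lborel)
      = ennreal (2 / 3) + ennreal \<beta> * ennreal (1 / 18)"
    unfolding g nn_integral_square[symmetric] nn_integral_state_sat_law_1_square[symmetric]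
    by (subst nn_integral_add) (auto intro!: nn_integral_cmult)
  also have "\<dots> = ennreal (2 / 3 + \<beta> / 18)"
    using assms(3) by (simp flip: ennreal_mult ennreal_plus)
  also have "\<dots> / 2 = ennreal (1 / 3 + \<beta> / 36)"
    using assms(3) divide_ennreal[of "2 / 3 + \<beta> / 18" 2] by (simp add: add_divide_distrib)
  finally show ?thesis .
qed

theorem theorem8:
  fixes M :: "'a measure" and X0 :: "'a \<Rightarrow> real" and \<beta> :: real
  assumes "prob_space M"
    and "X0 \<in> borel_measurable M"
    and "distr M lborel X0 = uniform_measure lborel {-1..1}"
    and "0 < \<beta>" and "\<beta> \<le> 1"
  shows "(INF F\<in>benchmark_gains. cost M X0 \<beta> (linear_law F)) = ennreal (1 / (3 * (1 - \<beta> / 4)))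
    \<and> (\<exists>!F. is_arg_min (\<lambda>F. cost M X0 \<beta> (linear_law F)) (\<lambda>F. F \<in> benchmark_gains) F)
    \<and> (\<forall>F. is_arg_min (\<lambda>F. cost M X0 \<beta> (linear_law F)) (\<lambda>F. F \<in> benchmark_gains) F
          \<longrightarrow> trajectory_admissible (linear_law F))
    \<and> {F. trajectory_admissible (linear_law F)} \<subseteq> benchmark_gains
    \<and> (INF F\<in>{F. trajectory_admissible (linear_law F)}. cost M X0 \<beta> (linear_law F))
        = (INF F\<in>benchmark_gains. cost M X0 \<beta> (linear_law F))
    \<and> two_relu_law sat_law
    \<and> trajectory_admissible sat_law
    \<and> cost M X0 \<beta> sat_law = ennreal (1 / 3 + \<beta> / 36)
    \<and> (\<forall>F\<in>benchmark_gains. cost M X0 \<beta> sat_law < cost M X0 \<beta> (linear_law F))"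
proof -
  let ?J = "\<lambda>F. cost M X0 \<beta> (linear_law F)"
  let ?c = "ennreal (1 / (3 * (1 - \<beta> / 4)))"
  note J = cost_linear_law[OF assms(2,3,4)]
  have J_min: "?J (- 1) = ?c"
    using assms(4,5) unfolding J by (simp add: power2_eq_square)
  have J_gt: "?c < ?J F" if "F \<in> benchmark_gains" "F \<noteq> - 1" for F
  proof -
    \<comment> \<open>Gains in the class satisfy \<open>F \<ge> -1\<close>, so 3/2 +
      \<open>F\<close> exceeds 1/2 once \<open>F\<close> differs from -1, and squaring preserves
      order between positive numbers.\<close>
    have "(1 / 2)\<^sup>2 < (3 / 2 + F)\<^sup>2"
      using that by (intro power_strict_mono) (auto simp: benchmark_gains_eq)
    then have "\<beta> / 4 < \<beta> * (3 / 2 + F)\<^sup>2"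
      using mult_strict_left_mono[OF _ assms(4), of "(1 / 2)\<^sup>2"] by (simp add: power_divide)
    then show ?thesis
      using assms(4,5) unfolding J
      by (auto intro!: ennreal_lessI divide_strict_left_mono mult_pos_pos)
  qed
  have J_ge: "?c \<le> ?J F" if "F \<in> benchmark_gains" for F
    using J_min J_gt[OF that] by (cases "F = - 1") auto
  have mem: "- 1 \<in> benchmark_gains"
    by (simp add: benchmark_gains_eq)
  \<comment> \<open>A general \<open>A\<close> serves both the benchmark class and the
    trajectory-wise admissible gains.\<close>
  have inf: "(INF F\<in>A. ?J F) = ?c" if "A \<subseteq> benchmark_gains" "- 1 \<in> A" for A
  proof (rule antisym)
    show "(INF F\<in>A. ?J F) \<le> ?c"
      using INF_lower[OF that(2), of ?J] by (simp add: J_min)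
    show "?c \<le> (INF F\<in>A. ?J F)"
      using that(1) J_ge by (intro INF_greatest) auto
  qed
  have arg_min: "is_arg_min ?J (\<lambda>F. F \<in> benchmark_gains) F \<longleftrightarrow> F = - 1" for F
    using J_min J_gt[of F] J_ge mem unfolding is_arg_min_def by (metis leD)
  have "1 / 3 + \<beta> / 36 < 1 / (3 * (1 - \<beta> / 4))"
  proof -
    \<comment> \<open>Clearing the positive denominator leaves the gap
      \<open>\<beta> / 6 + \<beta>\<^sup>2 / 48\<close>, which is positive.\<close>
    have "(1 / 3 + \<beta> / 36) * (3 * (1 - \<beta> / 4)) = 1 - \<beta> / 6 - \<beta>\<^sup>2 / 48"
      by (simp add: power2_eq_square field_simps)
    also have "\<dots> < 1" using assms(4) by (simp add: add_pos_pos diff_less_eq)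
    finally show ?thesis using assms(5) by (simp add: pos_less_divide_eq)
  qed
  then have "ennreal (1 / 3 + \<beta> / 36) < ?c"
    using assms(4,5) by (intro ennreal_lessI) auto
  then have sat_less: "cost M X0 \<beta> sat_law < ?J F" if "F \<in> benchmark_gains" for F
    using J_ge[OF that] cost_sat_law[OF assms(2,3,4)] by simp
  show ?thesis
    using inf[OF order.refl mem] inf[OF trajectory_admissible_linear_subset]
      arg_min trajectory_admissible_linear_minus_one trajectory_admissible_linear_subset
      two_relu_law_sat_law trajectory_admissible_sat_law cost_sat_law[OF assms(2,3,4)] sat_less
    by simp
qed

end
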